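(* Let $p,N\in\mathbb{N}$ with $p<N$, let $f:\mathbb{R}^{N\times p}\to\mathbb{R}$ be continuous, and let $S\in\mathrm{O}(N)$. Then $$\min_{U\in\mathrm{St}(p,N)}f(U)=\inf_{U\in\mathrm{St}(p,N)\setminus E_{N,p}(S)}f(U)=\inf_{V\in Q_{N,p}(S)}f\circ\Phi_S^{-1}(V).$$
   Context: Notation: $\mathrm{St}(p,N)=\{U\in\mathbb{R}^{N\times p}\mid U^TU=I_p\}$, $\mathrm{O}(N)=\mathrm{St}(N,N)$. $I$ is the $N\times N$ identity, $I_{N\times p}$ the matrix of its first $p$ columns, and $S_{\rm le}\in\mathbb{R}^{N\times p}$ is the block of the first $p$ columns of $S$. $E_{N,p}(S):=\{U\in\mathrm{St}(p,N)\mid\det(I_p+S_{\rm le}^TU)=0\}$, $$Q_{N,p}(S):=\left\{\begin{bmatrix}A&-B^T\\ B&0\end{bmatrix}\ \middle|\ A\in\mathbb{R}^{p\times p},\ A^T=-A,\ B\in\mathbb{R}^{(N-p)\times p}\right\},$$ and $\Phi_S^{-1}:Q_{N,p}(S)\to\mathrm{St}(p,N)\setminus E_{N,p}(S):V\mapsto S(I-V)(I+V)^{-1}I_{N\times p}$ is the (bijective) inverse of the generalized left-localized Cayley transform $\Phi_S$ centered at $S$. *)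

theory Defs
  imports "HOL-Analysis.Analysis"
begin

text \<open>
  An \<open>N \<times> p\<close> real matrix has type \<open>real^'p^'n\<close>. For \<open>p < N\<close> the row index type is the sum
  \<open>'p + 'q\<close>, so that \<open>CARD('p) = p\<close> and \<open>CARD('q) = N - p\<close> are arbitrary positive numbers;
  \<open>Inl\<close> marks the first \<open>p\<close> indices and \<open>Inr\<close> the remaining \<open>N - p\<close> ones.
\<close>

definition stiefel :: "(real^'p^'n) set" where
  "stiefel = {U. transpose U ** U = mat 1}"

abbreviation orthogonal_group :: "(real^'n^'n) set" where
  "orthogonal_group \<equiv> stiefel"

definition left_cols :: "real^('p::finite + 'q::finite)^'n \<Rightarrow> real^'p^'n" where
  "left_cols M = (\<chi> i j. M $ i $ Inl j)"

definition block_matrix ::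
  "real^('p::finite)^'p \<Rightarrow> real^('q::finite)^'p \<Rightarrow> real^'p^'q \<Rightarrow> real^'q^'q \<Rightarrow> real^('p + 'q)^('p + 'q)" where
  "block_matrix A B C D = (\<chi> i j. case i of
      Inl a \<Rightarrow> (case j of Inl b \<Rightarrow> A $ a $ b | Inr b \<Rightarrow> B $ a $ b)
    | Inr a \<Rightarrow> (case j of Inl b \<Rightarrow> C $ a $ b | Inr b \<Rightarrow> D $ a $ b))"

definition singular_set :: "real^('p::finite + 'q::finite)^('p + 'q) \<Rightarrow> (real^'p^('p + 'q)) set" where
  "singular_set S = {U \<in> stiefel. det (mat 1 + transpose (left_cols S) ** U) = 0}"

text \<open>The set \<open>Q\<^sub>N\<^sub>,\<^sub>p(S)\<close>; as a set of matrices it does not depend on the centre \<open>S\<close>.\<close>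

definition cayley_params :: "(real^('p::finite + 'q::finite)^('p + 'q)) set" where
  "cayley_params = {block_matrix A (- transpose B) B 0 | A B. transpose A = - A}"

text \<open>
  The inverse \<open>\<Phi>\<^sub>S\<^sup>-\<^sup>1\<close> of the Cayley transform. Elements of \<^term>\<open>cayley_params\<close> are
  skew-symmetric, so \<open>I + V\<close> is invertible there and \<^const>\<open>matrix_inv\<close> is the true inverse.
\<close>

definition inv_cayley ::
  "real^('p::finite + 'q::finite)^('p + 'q) \<Rightarrow> real^('p + 'q)^('p + 'q) \<Rightarrow> real^'p^('p + 'q)" where
  "inv_cayley S V = S ** (mat 1 - V) ** matrix_inv (mat 1 + V) ** left_cols (mat 1)"

end

theory Submission
  imports Defs
begin

text \<open>
  A continuous function attains its minimum on the compact set of orthonormal frames, so two things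
  remain: the Cayley transform parametrizes exactly the frames outside the singular set, and those
  frames are dense, so that discarding the singular ones does not change the infimum.

  \<^emph>\<open>Parametrization\<close> (\<open>inv_cayley_image\<close>). Let \<open>E\<close> be the first \<open>p\<close> columns of the identity and put
  \<open>W = S\<^sup>T U\<close>. Clearing the inverse turns \<open>\<Phi>\<^sub>S\<^sup>-\<^sup>1(V) = U\<close> into the linear equation
  \<open>V (E + W) = E - W\<close>, while \<open>I + S\<^sub>l\<^sub>e\<^sup>T U = E\<^sup>T (E + W)\<close>. If \<open>V\<close> is skew, the equation forces \<open>W\<close> to be a
  frame and \<open>E\<^sup>T (E + W)\<close> to be injective. Conversely, when \<open>E\<^sup>T (E + W)\<close> is invertible, the
  equation is solved by an explicit \<open>V\<close> whose lower right block vanishes, and \<open>V\<close> is skew because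
  \<open>(E - W)\<^sup>T (E + W)\<close> is.

  \<^emph>\<open>Density\<close> (\<open>nonsingular_dense_in_stiefel\<close>). Let now \<open>E\<close> be any frame, such as \<open>S\<^sub>l\<^sub>e\<close>. If \<open>x\<close> is
  a unit vector in the kernel of \<open>I + E\<^sup>T U\<close>, then equality holds in the Cauchy-Schwarz inequality and
  \<open>U x = - E x\<close>. As \<open>p < N\<close>, there is a unit vector \<open>e\<close> orthogonal to the range of \<open>U\<close>, and \<open>U x\<close>
  can be turned slightly in the plane of \<open>U x\<close> and \<open>e\<close> while \<open>U\<close> stays the same on the complement
  of \<open>x\<close>. This removes \<open>x\<close> from the kernel and adds nothing to it (\<open>shrink_kernel\<close>); after at most
  \<open>p\<close> such arbitrarily small rotations the determinant is nonzero.
\<close>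

section \<open>The Stiefel manifold\<close>

lemma inner_transpose_mult: "(transpose A *v x) \<bullet> y = x \<bullet> (A *v y)" for A :: "real^'n^'m"
  by (simp add: dot_lmul_matrix)

lemma skew_inner:
  fixes V :: "real^'n^'n"
  assumes "transpose V = - V"
  shows "(V *v x) \<bullet> y = - (x \<bullet> (V *v y))"
proof -
  have "V = - transpose V" using assms by simp
  then have "V *v x = - (transpose V *v x)"
    by (metis add_eq_0_iff matrix_vector_mult_0 matrix_vector_mult_add_rdistrib)
  then show ?thesis by (simp only: inner_minus_left inner_transpose_mult)
qed

lemma det_eq_0_iff_kernel: "det A = 0 \<longleftrightarrow> (\<exists>x\<noteq>0. A *v x = 0)" for A :: "real^'n^'n"
  by (metis invertible_det_nz invertible_left_inverse matrix_left_invertible_ker)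

lemma stiefel_iff_inner:
  "U \<in> stiefel \<longleftrightarrow> (\<forall>x y. (U *v x) \<bullet> (U *v y) = x \<bullet> y)" for U :: "real^'p^'n"
proof
  assume "U \<in> stiefel"
  then have "transpose U *v (U *v x) = x" for x
    by (simp only: matrix_vector_mul_assoc stiefel_def mem_Collect_eq matrix_vector_mul_lid)
  then show "\<forall>x y. (U *v x) \<bullet> (U *v y) = x \<bullet> y"
    by (metis inner_transpose_mult)
next
  assume *: "\<forall>x y. (U *v x) \<bullet> (U *v y) = x \<bullet> y"
  have "(transpose U *v (U *v x)) \<bullet> y = x \<bullet> y" for x y
    using * by (simp only: inner_transpose_mult)
  then have "transpose U *v (U *v x) = x" for x
    using vector_eq_rdot by blast
  then have "(transpose U ** U) *v x = mat 1 *v x" for x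
    by (simp only: matrix_vector_mul_assoc matrix_vector_mul_lid)
  then show "U \<in> stiefel"
    unfolding stiefel_def by (metis (mono_tags) mem_Collect_eq matrix_eq)
qed

text \<open>
  The columns of a frame are unit vectors, so its entries are bounded by one; preservation of the
  inner product is a closed condition.
\<close>

lemma compact_stiefel: "compact (stiefel :: (real^'p^'n) set)"
proof (rule compact_eq_bounded_closed[THEN iffD2, OF conjI])
  have entry: "\<bar>U $ i $ j\<bar> \<le> 1" if "U \<in> stiefel" for U :: "real^'p^'n" and i j
  proof -
    have "norm (U *v axis j 1) = 1"
      using that by (simp add: stiefel_iff_inner norm_eq_sqrt_inner inner_axis)
    moreover have "(U *v axis j 1) $ i = U $ i $ j"
      by (simp add: matrix_vector_mult_basis column_def)
    ultimately show ?thesis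
      using component_le_norm_cart[of "U *v axis j 1" i] by simp
  qed
  have "norm U \<le> (\<Sum>i\<in>(UNIV :: 'n set). \<Sum>j\<in>(UNIV :: 'p set). 1)"
    if "U \<in> stiefel" for U :: "real^'p^'n"
  proof -
    have "norm U \<le> (\<Sum>i\<in>UNIV. norm (U $ i))"
      unfolding norm_vec_def by (rule L2_set_le_sum) simp
    also have "\<dots> \<le> (\<Sum>i\<in>UNIV. \<Sum>j\<in>UNIV. \<bar>U $ i $ j\<bar>)"
      by (intro sum_mono norm_le_l1_cart)
    also have "\<dots> \<le> (\<Sum>i\<in>(UNIV :: 'n set). \<Sum>j\<in>(UNIV :: 'p set). 1)"
      by (intro sum_mono entry that)
    finally show ?thesis .
  qed
  then show "bounded (stiefel :: (real^'p^'n) set)"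
    unfolding bounded_iff by blast
  have "closed {U :: real^'p^'n. \<forall>x y. (U *v x) \<bullet> (U *v y) = x \<bullet> y}"
    unfolding matrix_vector_mult_def
    by (intro closed_Collect_all closed_Collect_eq continuous_intros)
  then show "closed (stiefel :: (real^'p^'n) set)"
    by (simp add: stiefel_iff_inner[symmetric])
qed

section \<open>Density of the nonsingular frames\<close>

text \<open>
  The spare direction towards which a frame can be rotated; the strict inequality \<open>p < N\<close> enters the
  argument only here. For \<open>p = N\<close> density fails: with \<open>E = I\<close>, every orthogonal matrix of
  determinant \<open>-1\<close> has the eigenvalue \<open>-1\<close>, so a whole component is singular.
\<close>

lemma unit_vector_orthogonal_to_range:
  fixes U :: "real^'p^'n"
  assumes "CARD('p) < CARD('n)"
  obtains e where "norm e = 1" "\<And>y. (U *v y) \<bullet> e = 0"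
proof -
  have "dim (range ((*v) U)) < DIM(real^'n)"
    using assms dim_image_le[of "(*v) U" UNIV] by (simp add: dim_UNIV)
  then obtain z where z: "z \<noteq> 0" "\<And>y. y \<in> span (range ((*v) U)) \<Longrightarrow> orthogonal z y"
    using orthogonal_to_subspace_exists by blast
  show ?thesis
  proof
    show "norm (z /\<^sub>R norm z) = 1" using z(1) by simp
    show "(U *v y) \<bullet> (z /\<^sub>R norm z) = 0" for y
      using z(2)[of "U *v y"] by (simp add: span_base orthogonal_def inner_commute)
  qed
qed

text \<open>
  A kernel vector satisfies \<open>\<langle>U x, E x\<rangle> = - |x|\<^sup>2\<close>. Both images have length \<open>|x|\<close>, so this is the
  equality case of the Cauchy-Schwarz inequality.
\<close>

lemma kernel_imp_antipodal:
  fixes E U :: "real^'p^'n"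
  assumes "E \<in> stiefel" "U \<in> stiefel" and "(mat 1 + transpose E ** U) *v x = 0"
  shows "U *v x = - (E *v x)"
proof -
  have "(transpose E *v (U *v x)) = - x"
    using assms(3) by (simp add: matrix_vector_mult_add_rdistrib matrix_vector_mul_assoc
        add_eq_0_iff del: transpose_matrix_vector)
  then have "(U *v x) \<bullet> (E *v x) = - (x \<bullet> x)"
    by (metis inner_minus_left inner_transpose_mult)
  then have "(U *v x + E *v x) \<bullet> (U *v x + E *v x) = 0"
    using assms(1,2) by (simp add: stiefel_iff_inner inner_add_left inner_add_right inner_commute)
  then show ?thesis by (simp add: eq_neg_iff_add_eq_0)
qed

text \<open>
  Rotate \<open>U x = - E x\<close> by a small angle \<open>t\<close> towards a unit vector orthogonal to the range of \<open>U\<close>,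
  and keep \<open>U\<close> on the complement of \<open>x\<close>. A kernel vector \<open>y\<close> of the rotated frame is sent to
  \<open>- E y\<close>; pairing this with \<open>E x\<close> gives \<open>(1 - cos t) \<langle>x, y\<rangle> = 0\<close>. Hence \<open>y\<close> is orthogonal to \<open>x\<close>,
  where the frame did not change, and \<open>y\<close> was in the old kernel already.
\<close>

lemma shrink_kernel:
  fixes E U :: "real^'p^'n"
  defines "ker \<equiv> (\<lambda>W :: real^'p^'n. {x. (mat 1 + transpose E ** W) *v x = 0})"
  assumes "CARD('p) < CARD('n)" and E: "E \<in> stiefel" and U: "U \<in> stiefel"
    and sing: "det (mat 1 + transpose E ** U) = 0" and "\<epsilon> > 0"
  obtains U' where "U' \<in> stiefel" "dist U' U < \<epsilon>" "dim (ker U') < dim (ker U)"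
proof -
  obtain x0 where x0: "x0 \<noteq> 0" "x0 \<in> ker U"
    using sing by (auto simp: det_eq_0_iff_kernel ker_def)
  define x where "x = x0 /\<^sub>R norm x0"
  have x1: "x \<bullet> x = 1" using x0(1) by (simp add: x_def dot_square_norm)
  have xker: "x \<in> ker U"
    using x0(2) by (simp add: x_def ker_def matrix_vector_mult_scaleR)
  have Ux: "U *v x = - (E *v x)"
    using kernel_imp_antipodal[OF E U] xker by (simp add: ker_def)
  obtain e where e: "norm e = 1" "\<And>y. (U *v y) \<bullet> e = 0"
    using unit_vector_orthogonal_to_range[OF assms(2), of U] by blast
  have ee: "e \<bullet> e = 1" using e(1) by (simp add: dot_square_norm)
  have Ee: "(E *v x) \<bullet> e = 0" using e(2)[of x] by (simp add: Ux)
  \<comment> \<open>The rank one matrix \<open>v x\<^sup>T\<close>. Adding it changes only the image of \<open>x\<close>, which for \<open>v = v t\<close> below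
     becomes \<open>- (cos t E x + sin t e)\<close>.\<close>
  define outer :: "real^'n \<Rightarrow> real^'p^'n" where "outer v = (\<chi> i j. v $ i * x $ j)" for v
  have outer: "outer v *v y = (x \<bullet> y) *\<^sub>R v" for v y
    by (simp add: outer_def vec_eq_iff matrix_vector_mult_def inner_vec_def sum_distrib_left mult_ac)
  define v where "v t = (1 - cos t) *\<^sub>R (E *v x) - sin t *\<^sub>R e" for t
  define R where "R t = U + outer (v t)" for t
  have Rv: "R t *v y = U *v y + (x \<bullet> y) *\<^sub>R v t" for t y
    by (simp add: R_def matrix_vector_mult_add_rdistrib outer)
  have UE: "(U *v y) \<bullet> (E *v x) = - (x \<bullet> y)" for y
  proof -
    have "E *v x = - (U *v x)" using Ux by simp
    then show ?thesis
      using U by (simp only: inner_minus_right stiefel_iff_inner inner_commute)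
  qed
  have Uv: "(U *v y) \<bullet> v t = - ((1 - cos t) * (x \<bullet> y))" for t y
    by (simp add: v_def inner_diff_right e(2) UE)
  have vv: "v t \<bullet> v t = 2 * (1 - cos t)" for t
  proof -
    have "v t \<bullet> v t = (1 - cos t)\<^sup>2 + (sin t)\<^sup>2"
      using E x1 ee Ee
      by (simp add: v_def inner_diff_left inner_diff_right inner_commute stiefel_iff_inner
          power2_eq_square)
    also have "\<dots> = 2 * (1 - cos t)"
      by (simp add: sin_squared_eq power2_eq_square algebra_simps)
    finally show ?thesis .
  qed
  have R_stiefel: "R t \<in> stiefel" for t
    unfolding stiefel_iff_inner
  proof (intro allI)
    fix y z
    have "(R t *v y) \<bullet> (R t *v z) = (U *v y) \<bullet> (U *v z) + (x \<bullet> z) * ((U *v y) \<bullet> v t)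
        + (x \<bullet> y) * ((U *v z) \<bullet> v t) + (x \<bullet> y) * (x \<bullet> z) * (v t \<bullet> v t)"
      by (simp add: Rv inner_add_left inner_add_right inner_commute algebra_simps)
    then show "(R t *v y) \<bullet> (R t *v z) = y \<bullet> z"
      using U unfolding Uv vv stiefel_iff_inner by (simp add: algebra_simps)
  qed
  have "continuous_on UNIV R"
    unfolding R_def v_def outer_def by (intro continuous_intros)
  then have "(R \<longlongrightarrow> R 0) (at 0)"
    by (simp add: continuous_on_eq_continuous_at isCont_def)
  moreover have "R 0 = U" by (simp add: R_def v_def outer_def vec_eq_iff)
  ultimately have "\<forall>\<^sub>F t in at 0. dist (R t) U < \<epsilon>"
    using \<open>\<epsilon> > 0\<close> by (simp add: tendstoD)
  then obtain d where d: "d > 0" "\<And>t. t \<noteq> 0 \<Longrightarrow> dist t 0 < d \<Longrightarrow> dist (R t) U < \<epsilon>"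
    unfolding eventually_at by auto
  \<comment> \<open>The bound \<open>1\<close> keeps \<open>t\<close> in \<open>(0, \<pi>)\<close>, where \<open>cos t < 1\<close>.\<close>
  define t where "t = min (d / 2) 1"
  have t: "0 < t" "t \<le> 1" "dist t 0 < d" using d(1) by (auto simp: t_def)
  have cos: "cos t < 1"
    using t cos_monotone_0_pi[of 0 t] pi_gt3 by simp
  have sub: "y \<in> ker U \<and> x \<bullet> y = 0" if "y \<in> ker (R t)" for y
  proof -
    have y: "R t *v y = - (E *v y)"
      using kernel_imp_antipodal[OF E R_stiefel] that by (simp add: ker_def)
    have "(R t *v y) \<bullet> (E *v x) = - (x \<bullet> y) + (x \<bullet> y) * (1 - cos t)"
    proof -
      have "v t \<bullet> (E *v x) = 1 - cos t"
        using E x1 Ee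
        by (simp add: v_def inner_diff_left inner_diff_right stiefel_iff_inner inner_commute)
      then show ?thesis by (simp add: Rv inner_add_left UE)
    qed
    moreover have "(R t *v y) \<bullet> (E *v x) = - (x \<bullet> y)"
      using E by (simp add: y stiefel_iff_inner inner_commute)
    ultimately have xy: "x \<bullet> y = 0" using cos by simp
    then have "U *v y = R t *v y" by (simp add: Rv)
    then have "y \<in> ker U"
      using that by (simp add: ker_def matrix_vector_mult_add_rdistrib
          matrix_vector_mul_assoc[symmetric] del: transpose_matrix_vector)
    then show ?thesis using xy by blast
  qed
  have subsp: "subspace (ker W)" for W
    unfolding ker_def by (intro linear_subspace_kernel) simp
  have "ker (R t) \<subset> ker U" using sub xker x1 by fastforce
  then have "dim (ker (R t)) < dim (ker U)"
    by (intro dim_psubset) (simp add: subsp span_eq_iff[THEN iffD2])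
  moreover have "dist (R t) U < \<epsilon>" using d(2) t by simp
  ultimately show ?thesis using that R_stiefel by blast
qed

lemma nonsingular_dense_in_stiefel:
  fixes E U :: "real^'p^'n"
  assumes "CARD('p) < CARD('n)" and "E \<in> stiefel" and "U \<in> stiefel" and "\<epsilon> > 0"
  shows "\<exists>U'\<in>stiefel. dist U' U < \<epsilon> \<and> det (mat 1 + transpose E ** U') \<noteq> 0"
  using assms(3,4)
proof (induction "dim {x. (mat 1 + transpose E ** U) *v x = 0}" arbitrary: U \<epsilon> rule: less_induct)
  case less
  show ?case
  proof (cases "det (mat 1 + transpose E ** U) = 0")
    case True
    have "\<epsilon> / 2 > 0" using less.prems by simp
    then obtain U1 where U1: "U1 \<in> stiefel" "dist U1 U < \<epsilon> / 2"
      and smaller: "dim {x. (mat 1 + transpose E ** U1) *v x = 0}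
        < dim {x. (mat 1 + transpose E ** U) *v x = 0}"
      using shrink_kernel[OF assms(1,2) less.prems(1) True] by blast
    obtain U' where U': "U' \<in> stiefel" "dist U' U1 < \<epsilon> / 2" "det (mat 1 + transpose E ** U') \<noteq> 0"
      using less.hyps[OF smaller U1(1) \<open>\<epsilon> / 2 > 0\<close>] by blast
    have "dist U' U < \<epsilon>"
      using dist_triangle_half_r[of U1 U' \<epsilon> U] U1(2) U'(2) by (simp add: dist_commute)
    with U' show ?thesis by blast
  next
    case False
    with less.prems show ?thesis by (intro bexI[of _ U]) auto
  qed
qed

section \<open>The parameter space\<close>

lemma block_matrix_nth [simp]:
  "block_matrix A B C D $ Inl a $ Inl b = A $ a $ b"
  "block_matrix A B C D $ Inl a $ Inr b' = B $ a $ b'"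
  "block_matrix A B C D $ Inr a' $ Inl b = C $ a' $ b"
  "block_matrix A B C D $ Inr a' $ Inr b' = D $ a' $ b'"
  by (simp_all add: block_matrix_def)

text \<open>
  This description avoids the blocks: skewness and the vanishing lower right corner can be checked
  for a matrix given as a product.
\<close>

lemma cayley_params_iff:
  fixes V :: "real^('p::finite + 'q::finite)^('p + 'q)"
  shows "V \<in> cayley_params \<longleftrightarrow> transpose V = - V \<and> (\<forall>i j. V $ Inr i $ Inr j = 0)"
proof
  assume "V \<in> cayley_params"
  then obtain A :: "real^'p^'p" and B :: "real^'p^'q" where
    V: "V = block_matrix A (- transpose B) B 0" and A: "transpose A = - A"
    by (auto simp: cayley_params_def)
  have skew: "A $ j $ i = - A $ i $ j" for i j
    using arg_cong[OF A, of "\<lambda>M. M $ i $ j"] by (simp add: transpose_def)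
  have "transpose V $ i $ j = - V $ i $ j" for i j
    unfolding V by (cases i; cases j) (auto simp: transpose_def intro: skew)
  then show "transpose V = - V \<and> (\<forall>i j. V $ Inr i $ Inr j = 0)"
    by (simp add: vec_eq_iff V)
next
  assume *: "transpose V = - V \<and> (\<forall>i j. V $ Inr i $ Inr j = 0)"
  have skew: "V $ j $ i = - V $ i $ j" for i j
    using arg_cong[OF conjunct1[OF *], of "\<lambda>M. M $ i $ j"] by (simp add: transpose_def)
  define A :: "real^'p^'p" where "A = (\<chi> i j. V $ Inl i $ Inl j)"
  define B :: "real^'p^'q" where "B = (\<chi> i j. V $ Inr i $ Inl j)"
  have "V $ i $ j = block_matrix A (- transpose B) B 0 $ i $ j" for i j
    by (cases i; cases j) (auto simp: A_def B_def transpose_def * intro: skew)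
  then have "V = block_matrix A (- transpose B) B 0" by (simp add: vec_eq_iff)
  moreover have "transpose A = - A"
    by (auto simp: A_def transpose_def vec_eq_iff intro: skew)
  ultimately show "V \<in> cayley_params" by (auto simp: cayley_params_def)
qed

section \<open>Matrix algebra\<close>

lemma matrix_diff_ldistrib: "A ** (B - C) = A ** B - A ** C" for A :: "real^'n^'m"
  by (simp add: matrix_matrix_mult_def vec_eq_iff right_diff_distrib sum_subtractf)

lemma matrix_diff_rdistrib: "(B - C) ** A = B ** A - C ** A" for A :: "real^'n^'m"
  by (simp add: matrix_matrix_mult_def vec_eq_iff left_diff_distrib sum_subtractf)

lemma matrix_add_rdistrib: "(B + C) ** A = B ** A + C ** A" for A :: "real^'n^'m"
  by (simp add: matrix_matrix_mult_def vec_eq_iff distrib_right sum.distrib)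

lemma transpose_add: "transpose (A + B) = transpose A + transpose B"
  by (simp add: transpose_def vec_eq_iff)

lemma transpose_diff: "transpose (A - B) = transpose A - transpose (B :: real^'n^'m)"
  by (simp add: transpose_def vec_eq_iff)

lemma matrix_neg_left: "(- A) ** B = - (A ** B)" for A :: "real^'n^'m"
  by (simp add: matrix_matrix_mult_def vec_eq_iff sum_negf)

lemma matrix_neg_right: "A ** (- B) = - (A ** B)" for A :: "real^'n^'m"
  by (simp add: matrix_matrix_mult_def vec_eq_iff sum_negf)

lemma left_cols_eq_mult: "left_cols S = S ** left_cols (mat 1)"
proof -
  have "(\<Sum>k\<in>UNIV. S $ i $ k * (if k = Inl j then 1 else 0)) = S $ i $ Inl j" for i j
    by (simp add: if_distrib cong: if_cong)
  then show ?thesis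
    by (simp add: left_cols_def matrix_matrix_mult_def mat_def vec_eq_iff)
qed

lemma stiefel_mult:
  "A \<in> stiefel \<Longrightarrow> B \<in> stiefel \<Longrightarrow> A ** B \<in> stiefel"
  by (simp add: stiefel_iff_inner matrix_vector_mul_assoc[symmetric])

lemma orthogonal_group_transpose: "S \<in> orthogonal_group \<Longrightarrow> transpose S \<in> orthogonal_group"
  by (simp add: stiefel_def matrix_left_right_inverse)

lemma left_cols_mat_1_stiefel: "left_cols (mat 1) \<in> (stiefel :: (real^'p::finite^('p + 'q::finite)) set)"
proof -
  have "(if k = Inl i then 1 else 0) * (if k = Inl j then 1 else 0)
      = (if k = Inl j then if i = j then 1 else 0 else (0::real))" for i j :: 'p and k :: "'p + 'q"
    by auto
  then show ?thesis
    by (simp add: stiefel_def left_cols_def transpose_def matrix_matrix_mult_def mat_def vec_eq_iff)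
qed

lemma left_cols_stiefel:
  fixes S :: "real^('p::finite + 'q::finite)^('p + 'q)"
  assumes "S \<in> orthogonal_group" shows "left_cols S \<in> stiefel"
  using left_cols_eq_mult[of S] stiefel_mult[OF assms left_cols_mat_1_stiefel] by simp

lemma matrix_inv_inverse:
  assumes "invertible A" shows "A ** matrix_inv A = mat 1" "matrix_inv A ** A = mat 1"
  using someI_ex[OF assms[unfolded invertible_def]] by (simp_all add: matrix_inv_def)

section \<open>The Cayley parametrization\<close>

text \<open>If \<open>V x = - x\<close> with \<open>V\<close> skew, then \<open>|x|\<^sup>2 = - \<langle>x, V x\<rangle> = 0\<close>.\<close>

lemma invertible_one_plus_skew:
  fixes V :: "real^'n^'n"
  assumes "transpose V = - V" shows "invertible (mat 1 + V)"
proof -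
  have "x = 0" if "(mat 1 + V) *v x = 0" for x
  proof -
    have "V *v x = - x" using that by (simp add: matrix_vector_mult_add_rdistrib add_eq_0_iff)
    then show ?thesis using skew_inner[OF assms, of x x] by simp
  qed
  then show ?thesis
    by (metis invertible_left_inverse matrix_left_invertible_ker)
qed

lemma mult_eq_iff:
  assumes "K ** J = mat 1" "J ** K = mat 1"
  shows "J ** A = B \<longleftrightarrow> A = K ** B"
  using assms by (metis matrix_mul_assoc matrix_mul_lid)

text \<open>
  Since \<open>(I - V) (I + V)\<^sup>-\<^sup>1 = 2 (I + V)\<^sup>-\<^sup>1 - I\<close>, the equation \<open>\<Phi>\<^sub>S\<^sup>-\<^sup>1(V) = U\<close> says
  \<open>2 (I + V)\<^sup>-\<^sup>1 E = E + W\<close>; multiplying by \<open>I + V\<close> makes it linear in \<open>V\<close>.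
\<close>

lemma inv_cayley_eq_iff:
  fixes S :: "real^('p::finite + 'q::finite)^('p + 'q)" and U :: "real^'p^('p + 'q)"
  defines "E \<equiv> left_cols (mat 1) :: real^'p^('p + 'q)" and "W \<equiv> transpose S ** U"
  assumes S: "S \<in> orthogonal_group" and V: "transpose V = - V"
  shows "inv_cayley S V = U \<longleftrightarrow> V ** (E + W) = E - W"
proof -
  define J where "J = matrix_inv (mat 1 + V)"
  have J: "(mat 1 + V) ** J = mat 1" "J ** (mat 1 + V) = mat 1"
    using invertible_one_plus_skew[OF V] by (simp_all add: J_def matrix_inv_inverse)
  have S1: "transpose S ** S = mat 1" "S ** transpose S = mat 1"
    using S by (simp_all add: stiefel_def matrix_left_right_inverse)
  have "(mat 1 - V) ** J + (mat 1 + V) ** J = J + J"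
    by (simp add: matrix_add_rdistrib matrix_diff_rdistrib)
  then have VJ: "(mat 1 - V) ** J = J + J - mat 1"
    unfolding J by (simp add: eq_diff_eq)
  have inv: "inv_cayley S V = S ** (J ** (E + E) - E)"
  proof -
    have "inv_cayley S V = S ** ((mat 1 - V) ** J ** E)"
      by (simp add: inv_cayley_def J_def E_def matrix_mul_assoc)
    also have "(mat 1 - V) ** J ** E = J ** (E + E) - E"
      unfolding VJ
      by (simp only: matrix_add_ldistrib matrix_add_rdistrib matrix_diff_rdistrib matrix_mul_lid)
    finally show ?thesis .
  qed
  have "inv_cayley S V = U \<longleftrightarrow> J ** (E + E) - E = W"
    unfolding inv W_def using S1 by (subst mult_eq_iff[of "transpose S" S]) auto
  also have "\<dots> \<longleftrightarrow> J ** (E + E) = E + W" by (auto simp: algebra_simps)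
  also have "\<dots> \<longleftrightarrow> E + E = (mat 1 + V) ** (E + W)"
    using J by (rule mult_eq_iff)
  also have "\<dots> \<longleftrightarrow> V ** (E + W) = E - W"
    by (auto simp: matrix_add_rdistrib algebra_simps)
  finally show ?thesis .
qed

text \<open>
  Both inclusions rest on the linear equation above. Forwards, if \<open>x\<close> is in the kernel of \<open>E\<^sup>T (E + W)\<close>
  then \<open>z = (E + W) x\<close> satisfies \<open>(I + V) z = 2 E x\<close> and is orthogonal to \<open>E x\<close>; pairing with \<open>z\<close>
  gives \<open>z = 0\<close>, so \<open>E x = 0\<close>. Backwards, a suitable \<open>V\<close> is written down.
\<close>

lemma inv_cayley_image:
  fixes S :: "real^('p::finite + 'q::finite)^('p + 'q)"
  assumes S: "S \<in> orthogonal_group"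
  shows "inv_cayley S ` cayley_params = stiefel - singular_set S"
proof -
  define E where "E = (left_cols (mat 1) :: real^'p^('p + 'q))"
  have E: "E \<in> stiefel" unfolding E_def by (rule left_cols_mat_1_stiefel)
  have EE: "transpose E ** E = mat 1" using E by (simp add: stiefel_def)
  have St: "transpose S \<in> orthogonal_group" using orthogonal_group_transpose[OF S] .
  have P: "mat 1 + transpose (left_cols S) ** U = transpose E ** (E + transpose S ** U)" for U
  proof -
    have "left_cols S = S ** E" using left_cols_eq_mult[of S] by (simp add: E_def)
    then show ?thesis by (simp add: matrix_add_ldistrib EE matrix_transpose_mul matrix_mul_assoc)
  qed
  show ?thesis
  proof (intro subset_antisym subsetI)
    fix U assume "U \<in> inv_cayley S ` cayley_params"
    then obtain V where U: "inv_cayley S V = U" and "V \<in> cayley_params" by blast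
    then have skew: "transpose V = - V" by (simp add: cayley_params_iff)
    define W where "W = transpose S ** U"
    have eq: "V ** (E + W) = E - W"
      using U inv_cayley_eq_iff[OF S skew] by (simp add: E_def W_def)
    have Vx: "V *v (E *v x + W *v x) = E *v x - W *v x" for x
      using arg_cong[OF eq, of "\<lambda>M. M *v x"]
      by (simp add: matrix_vector_mul_assoc[symmetric] matrix_vector_mult_add_rdistrib
          matrix_vector_mult_diff_rdistrib)
    \<comment> \<open>The bilinear form of \<open>V\<close> is antisymmetric on the vectors \<open>(E + W) x\<close>, and
       \<open>\<langle>(E + W) x, (E - W) y\<rangle> + \<langle>(E - W) x, (E + W) y\<rangle> = 2 \<langle>E x, E y\<rangle> - 2 \<langle>W x, W y\<rangle>\<close>.\<close>
    have "(W *v x) \<bullet> (W *v y) = x \<bullet> y" for x y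
      using skew_inner[OF skew, of "E *v x + W *v x" "E *v y + W *v y"] E
      unfolding Vx stiefel_iff_inner
      by (simp add: inner_add_left inner_add_right inner_diff_left inner_diff_right inner_commute)
    then have "W \<in> stiefel" by (simp add: stiefel_iff_inner)
    moreover have "U = S ** W"
      using St by (simp add: W_def stiefel_def matrix_mul_assoc)
    ultimately have "U \<in> stiefel" using S stiefel_mult by blast
    moreover have "det (transpose E ** (E + W)) \<noteq> 0"
      unfolding det_eq_0_iff_kernel
    proof clarify
      fix x :: "real^'p" assume "x \<noteq> 0" and x: "(transpose E ** (E + W)) *v x = 0"
      define z where "z = E *v x + W *v x"
      have "transpose E *v z = 0"
        using x by (simp add: z_def matrix_vector_mul_assoc[symmetric]
            matrix_vector_mult_add_rdistrib del: transpose_matrix_vector)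
      then have "z \<bullet> (E *v x) = 0" by (metis inner_transpose_mult inner_zero_left)
      moreover have "z + V *v z = 2 *\<^sub>R (E *v x)" using Vx[of x] by (simp add: z_def scaleR_2)
      moreover have "z \<bullet> (V *v z) = 0" using skew_inner[OF skew, of z z] by (simp add: inner_commute)
      ultimately have "z \<bullet> z = 0"
        by (metis add.right_neutral inner_add_right inner_scaleR_right mult_zero_right)
      then have "E *v x = 0" using \<open>z + V *v z = 2 *\<^sub>R (E *v x)\<close> by simp
      then have "x \<bullet> x = 0" using E by (metis inner_zero_left stiefel_iff_inner)
      with \<open>x \<noteq> 0\<close> show False by simp
    qed
    ultimately show "U \<in> stiefel - singular_set S"
      by (simp add: singular_set_def P W_def)
  next
    fix U assume "U \<in> stiefel - singular_set S"
    then have U: "U \<in> stiefel" and det: "det (mat 1 + transpose (left_cols S) ** U) \<noteq> 0"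
      by (auto simp: singular_set_def)
    define W where "W = transpose S ** U"
    have W: "transpose W ** W = mat 1"
      using stiefel_mult[OF St U] by (simp add: W_def stiefel_def)
    define Z where "Z = E + W"
    define D where "D = E - W"
    have "invertible (transpose E ** Z)"
      using det by (simp add: invertible_det_nz P W_def Z_def)
    then obtain T where T: "transpose E ** Z ** T = mat 1" "T ** (transpose E ** Z) = mat 1"
      by (auto simp: invertible_def)
    \<comment> \<open>Normalize \<open>V Z = D\<close> to \<open>V G = H\<close>, where the upper block of \<open>G\<close> is the identity.\<close>
    define G where "G = Z ** T"
    define H where "H = D ** T"
    have EG: "transpose E ** G = mat 1" using T(1) by (simp add: G_def matrix_mul_assoc)
    have "transpose Z ** D = - (transpose D ** Z)"
      by (simp add: Z_def D_def transpose_add transpose_diff matrix_add_ldistrib matrix_add_rdistrib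
          matrix_diff_ldistrib matrix_diff_rdistrib EE W)
    then have "transpose T ** (transpose Z ** D) ** T = - (transpose T ** (transpose D ** Z) ** T)"
      by (simp add: matrix_neg_left matrix_neg_right)
    then have GH: "transpose G ** H = - (transpose H ** G)"
      by (simp add: G_def H_def matrix_transpose_mul matrix_mul_assoc)
    \<comment> \<open>As \<open>E\<^sup>T G = I\<close>, the first term alone maps \<open>G\<close> to \<open>H\<close>. The second makes the sum of the first
       two skew, and the third, skew itself, cancels the second on \<open>G\<close>. Every term has \<open>E\<close> on the left
       or \<open>E\<^sup>T\<close> on the right, so the lower right block is zero.\<close>
    define V where "V = H ** transpose E - E ** transpose H + E ** (transpose H ** G) ** transpose E"
    have "transpose V = E ** transpose H - H ** transpose E
        + E ** (transpose G ** H) ** transpose E"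
      by (simp add: V_def transpose_add transpose_diff matrix_transpose_mul matrix_mul_assoc)
    also have "\<dots> = - V"
      by (simp add: GH V_def matrix_neg_left matrix_neg_right)
    finally have skew: "transpose V = - V" .
    have "V $ Inr i $ Inr j = 0" for i j
      by (simp add: V_def E_def left_cols_def mat_def transpose_def matrix_matrix_mult_def)
    then have "V \<in> cayley_params" using skew by (simp add: cayley_params_iff)
    moreover have "V ** G = H"
    proof -
      have "V ** G = H ** (transpose E ** G) - E ** (transpose H ** G)
          + E ** (transpose H ** G) ** (transpose E ** G)"
        by (simp add: V_def matrix_add_rdistrib matrix_diff_rdistrib matrix_mul_assoc)
      then show ?thesis by (simp add: EG)
    qed
    then have "V ** Z = D"
      unfolding G_def H_def by (metis T(2) matrix_mul_assoc matrix_mul_rid)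
    then have "inv_cayley S V = U"
      using inv_cayley_eq_iff[OF S skew] by (simp add: E_def W_def Z_def D_def)
    ultimately show "U \<in> inv_cayley S ` cayley_params" by blast
  qed
qed

section \<open>Minimum and infima\<close>

lemma min_eq_INF_over_dense:
  fixes f :: "'a::metric_space \<Rightarrow> real"
  assumes cont: "isCont f u" and min: "\<And>d. d \<in> D \<Longrightarrow> f u \<le> f d"
    and dense: "\<And>\<epsilon>. \<epsilon> > 0 \<Longrightarrow> \<exists>d\<in>D. dist d u < \<epsilon>"
  shows "ereal (f u) = (INF d\<in>D. ereal (f d))"
proof (rule antisym)
  show "ereal (f u) \<le> (INF d\<in>D. ereal (f d))"
    using min by (intro INF_greatest) simp
  show "(INF d\<in>D. ereal (f d)) \<le> ereal (f u)"
  proof (rule ereal_le_epsilon2)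
    fix \<epsilon> :: real assume "\<epsilon> > 0"
    then obtain \<delta> where "\<delta> > 0" and \<delta>: "\<And>d. dist d u < \<delta> \<Longrightarrow> dist (f d) (f u) < \<epsilon>"
      using cont unfolding continuous_at_eps_delta by blast
    then obtain d where "d \<in> D" "dist (f d) (f u) < \<epsilon>" using dense by blast
    then show "(INF d\<in>D. ereal (f d)) \<le> ereal (f u) + ereal \<epsilon>"
      by (intro INF_lower2[of d]) (auto simp: dist_real_def)
  qed
qed

theorem lemma2p6:
  fixes f :: "real^'p^('p::finite + 'q::finite) \<Rightarrow> real"
    and S :: "real^('p + 'q)^('p + 'q)"
  assumes "continuous_on UNIV f"
    and "S \<in> orthogonal_group"
  shows "\<exists>U0 \<in> stiefel. (\<forall>U \<in> stiefel. f U0 \<le> f U)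
    \<and> ereal (f U0) = (INF U \<in> stiefel - singular_set S. ereal (f U))
    \<and> (INF U \<in> stiefel - singular_set S. ereal (f U))
        = (INF V \<in> cayley_params. ereal ((f \<circ> inv_cayley S) V))"
proof -
  let ?D = "stiefel - singular_set S"
  have "stiefel \<noteq> ({} :: (real^'p^('p + 'q)) set)"
    using left_cols_mat_1_stiefel by blast
  then obtain U0 where U0: "U0 \<in> stiefel" and min: "\<forall>U\<in>stiefel. f U0 \<le> f U"
    using continuous_attains_inf[OF compact_stiefel] assms(1)
    by (metis continuous_on_subset subset_UNIV)
  have "CARD('p) < CARD('p + 'q)" by (simp add: card_UNIV_sum)
  then have dense: "\<exists>U\<in>?D. dist U U0 < \<epsilon>" if "\<epsilon> > 0" for \<epsilon>
    using nonsingular_dense_in_stiefel[OF _ left_cols_stiefel[OF assms(2)] U0 that]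
    by (fastforce simp: singular_set_def)
  have "isCont f U0" using assms(1) by (simp add: continuous_on_eq_continuous_at)
  then have "ereal (f U0) = (INF U\<in>?D. ereal (f U))"
    using min dense by (intro min_eq_INF_over_dense) auto
  moreover have "(INF U\<in>?D. ereal (f U)) = (INF V\<in>cayley_params. ereal ((f \<circ> inv_cayley S) V))"
    by (simp add: inv_cayley_image[OF assms(2), symmetric] image_image)
  ultimately show ?thesis using U0 min by blast
qed

end
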